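(* Let $a,b,d$ be pairwise relatively prime positive integers with $d\ge 2$, and let $a^*$ be the unique integer satisfying $aa^*\equiv 1\pmod d$ and $1\le a^*\le d-1$. Then $$g\left(\langle a,b\rangle/d\right)=\frac{(a-1)(b+d-a^*ab)}{2d}+\frac12\left\lfloor\frac{a-1}{d}\right\rfloor\left(a^*b\left\lfloor\frac{a-1}{d}\right\rfloor+a^*b-2\right)+\sum_{\substack{1\le j\le a-1\\ d\nmid j}}\left\lfloor\frac{a^*bj}{d}\right\rfloor .$$
   Context: $\mathbb{N}$ denotes the set of nonnegative integers. A numerical semigroup is a subset of $\mathbb{N}$ that is closed under addition, contains $0$, and has finite complement in $\mathbb{N}$. For relatively prime positive integers $a,b$, $\langle a,b\rangle=\{c_1a+c_2b: c_1,c_2\in\mathbb{N}\}$, which is a numerical semigroup. For a numerical semigroup $S$ and a positive integer $d$, $S/d=\{x\in\mathbb{N}: dx\in S\}$, which is again a numerical semigroup. The genus of a numerical semigroup $S$ is $g(S)=|\mathbb{N}\setminus S|$. *)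

theory Defs
  imports Complex_Main "HOL-Number_Theory.Cong"
begin

definition numerical_semigroup :: "nat set \<Rightarrow> bool" where
  "numerical_semigroup S \<longleftrightarrow>
     0 \<in> S \<and> (\<forall>x\<in>S. \<forall>y\<in>S. x + y \<in> S) \<and> finite (UNIV - S)"

definition semigroup_gen2 :: "nat \<Rightarrow> nat \<Rightarrow> nat set" where
  "semigroup_gen2 a b = {c1 * a + c2 * b | c1 c2. True}"

definition semigroup_quotient :: "nat set \<Rightarrow> nat \<Rightarrow> nat set" where
  "semigroup_quotient S d = {x. d * x \<in> S}"

(* card is 0 on infinite sets, so this is the genus only when S has finite
   complement; the two lemmas below show that this holds for <a,b>/d. *)
definition genus :: "nat set \<Rightarrow> nat" where
  "genus S = card (UNIV - S)"

lemma numerical_semigroup_gen2: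
  assumes "a > 0" "b > 0" "coprime a b"
  shows "numerical_semigroup (semigroup_gen2 a b)"
proof -
  have "n \<in> semigroup_gen2 a b" if n: "n \<ge> a * b" for n
  proof -
    obtain x where x: "[a * x = Suc 0] (mod b)"
      using cong_solve_coprime_nat assms(3) by blast
    define c where "c = (x * n) mod b"
    have "[c * a = x * n * a] (mod b)"
      unfolding c_def by (simp add: cong_def mod_mult_left_eq)
    also have "[x * n * a = n] (mod b)"
      using cong_scalar_right[OF x, of n] by (simp add: mult_ac)
    finally have cg: "[c * a = n] (mod b)" .
    have "c < b"
      unfolding c_def using assms(2) by simp
    then have "c * a \<le> n"
      using n by (metis le_trans less_imp_le_nat mult.commute mult_le_mono1)
    moreover from this cg have "b dvd n - c * a"
      by (metis cong_altdef_nat cong_sym)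
    then obtain k where "n - c * a = b * k" ..
    ultimately have "n = c * a + k * b"
      by (simp add: mult.commute)
    then show ?thesis
      unfolding semigroup_gen2_def by blast
  qed
  then have "UNIV - semigroup_gen2 a b \<subseteq> {..<a * b}"
    by (auto simp: not_le[symmetric])
  then have "finite (UNIV - semigroup_gen2 a b)"
    using finite_subset by blast
  moreover have "0 \<in> semigroup_gen2 a b"
    unfolding semigroup_gen2_def by force
  moreover have "x + y \<in> semigroup_gen2 a b"
    if xy: "x \<in> semigroup_gen2 a b" "y \<in> semigroup_gen2 a b" for x y
  proof -
    obtain c1 c2 e1 e2 where "x = c1 * a + c2 * b" "y = e1 * a + e2 * b"
      using xy unfolding semigroup_gen2_def by blast
    then have "x + y = (c1 + e1) * a + (c2 + e2) * b"
      by (simp add: algebra_simps)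
    then show ?thesis
      unfolding semigroup_gen2_def by blast
  qed
  ultimately show ?thesis
    unfolding numerical_semigroup_def by blast
qed

lemma numerical_semigroup_quotient:
  assumes "numerical_semigroup S" "d > 0"
  shows "numerical_semigroup (semigroup_quotient S d)"
proof -
  have "UNIV - semigroup_quotient S d = (\<lambda>x. d * x) -` (UNIV - S)"
    unfolding semigroup_quotient_def by auto
  moreover have "inj (\<lambda>x. d * x)"
    using assms(2) by (simp add: inj_on_def)
  ultimately have "finite (UNIV - semigroup_quotient S d)"
    using assms(1) finite_vimageI unfolding numerical_semigroup_def by metis
  then show ?thesis
    using assms(1) unfolding numerical_semigroup_def semigroup_quotient_def
    by (simp add: distrib_left)
qed

end

theory Submission
  imports Defs
begin

text \<open>
  The gaps of \<open>\<langle>a, b\<rangle>\<close> are exactly the positive integers \<open>j b - k a\<close> with \<open>1 \<le> j \<le> a - 1\<close> and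
  \<open>k \<ge> 1\<close>, and \<open>j\<close>, \<open>k\<close> are determined by the gap. A gap of \<open>\<langle>a, b\<rangle>/d\<close> is a gap of \<open>\<langle>a, b\<rangle>\<close>
  divisible by \<open>d\<close>, divided by \<open>d\<close>. Divisibility of \<open>j b - k a\<close> by \<open>d\<close> means \<open>k \<equiv> c\<close> modulo \<open>d\<close>,
  where \<open>c = a\<^sup>* b j\<close>. So the genus is the sum over \<open>j\<close> of the number of \<open>k\<close> in this residue class
  with \<open>1 \<le> k \<le> \<lfloor>j b / a\<rfloor>\<close>, that is, of
  \<open>\<lfloor>(\<lfloor>j b / a\<rfloor> - c) / d\<rfloor> - \<lfloor>- c / d\<rfloor>\<close>.

  Write \<open>a a\<^sup>* = 1 + d m\<close>. The first floor is then \<open>\<lfloor>- j b m / a\<rfloor>\<close>, and since \<open>b m\<close> is prime to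
  \<open>a\<close>, the reflection \<open>j \<mapsto> a - j\<close> sums it in closed form (\<open>sum_neg_mult_div_coprime\<close>). The second
  is \<open>- \<lceil>c / d\<rceil>\<close>: for \<open>d\<close> not dividing \<open>j\<close> the ceiling is \<open>\<lfloor>c / d\<rfloor> + 1\<close>, which leaves the sum in
  the formula, and the multiples \<open>j = d i\<close> contribute an arithmetic progression \<open>a\<^sup>* b i\<close> with
  \<open>1 \<le> i \<le> \<lfloor>(a - 1) / d\<rfloor>\<close>.
\<close>

section \<open>Gaps of a two-generated semigroup and of its quotient\<close>

lemma coprime_mult_dvd_diff_imp_eq:
  fixes a b i j :: nat
  assumes "coprime a b" "i < a" "j < a" "int a dvd int b * (int i - int j)"
  shows "i = j"
proof -
  have "int a dvd int i - int j"
    using assms(1,4) by (simp add: coprime_dvd_mult_right_iff)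
  then have "[int i = int j] (mod int a)"
    by (simp add: cong_iff_dvd_diff)
  then show ?thesis
    using assms(2,3) by (simp add: cong_int_iff cong_less_modulus_unique_nat)
qed

lemma semigroup_gen2_iff_int:
  "n \<in> semigroup_gen2 a b \<longleftrightarrow> (\<exists>p q. int n = p * int a + q * int b \<and> p \<ge> 0 \<and> q \<ge> 0)"
proof
  assume "n \<in> semigroup_gen2 a b"
  then obtain c1 c2 where "n = c1 * a + c2 * b"
    unfolding semigroup_gen2_def by blast
  then have "int n = int c1 * int a + int c2 * int b"
    by simp
  then show "\<exists>p q. int n = p * int a + q * int b \<and> p \<ge> 0 \<and> q \<ge> 0"
    by (metis of_nat_0_le_iff)
next
  assume "\<exists>p q. int n = p * int a + q * int b \<and> p \<ge> 0 \<and> q \<ge> 0"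
  then obtain p q where "int n = int (nat p) * int a + int (nat q) * int b"
    by (metis int_nat_eq)
  then have "n = nat p * a + nat q * b"
    by (metis of_nat_add of_nat_eq_iff of_nat_mult)
  then show "n \<in> semigroup_gen2 a b"
    unfolding semigroup_gen2_def by blast
qed

text \<open>
  A number \<open>n\<close> is congruent to \<open>j b\<close> modulo \<open>a\<close> for a unique \<open>j < a\<close>, and \<open>j b\<close> is the least element
  of \<open>\<langle>a, b\<rangle>\<close> in its class; so \<open>n\<close> is a gap precisely if it lies below \<open>j b\<close>.
\<close>
lemma gap_gen2_iff:
  assumes "a > 0" "coprime a b"
  shows "n \<notin> semigroup_gen2 a b \<longleftrightarrow>
    (\<exists>j k. j \<in> {1..a - 1} \<and> k \<ge> 1 \<and> int n = int j * int b - k * int a)"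
proof
  assume gap: "n \<notin> semigroup_gen2 a b"
  obtain y where y: "[b * y = 1] (mod a)"
    using cong_solve_coprime_nat assms(2) by (metis One_nat_def coprime_commute)
  \<comment> \<open>the representative below \<open>a\<close> of \<open>n / b\<close> modulo \<open>a\<close>\<close>
  define j where "j = (y * n) mod a"
  have "[j * b = y * n * b] (mod a)"
    unfolding j_def by (simp add: cong_def mod_mult_left_eq)
  also have "[y * n * b = n] (mod a)"
    using cong_scalar_right[OF y, of n] by (simp add: mult_ac)
  finally have "int a dvd int j * int b - int n"
    by (simp flip: cong_int_iff add: cong_iff_dvd_diff)
  then obtain k where "int j * int b - int n = int a * k" ..
  then have eq: "int n = (- k) * int a + int j * int b"
    by (simp add: algebra_simps)
  have "k \<ge> 1"
  proof (rule ccontr)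
    assume "\<not> k \<ge> 1"
    then show False
      using gap eq unfolding semigroup_gen2_iff_int
      by (metis linorder_not_le neg_0_le_iff_le of_nat_0_le_iff zero_less_one
          int_one_le_iff_zero_less not_less)
  qed
  moreover have "j \<noteq> 0"
  proof
    assume "j = 0"
    then have "int n = - (k * int a)"
      using eq by simp
    moreover have "k * int a > 0"
      using \<open>k \<ge> 1\<close> assms(1) by simp
    ultimately show False
      by simp
  qed
  moreover have "j < a"
    unfolding j_def using assms(1) by simp
  ultimately show "\<exists>j k. j \<in> {1..a - 1} \<and> k \<ge> 1 \<and> int n = int j * int b - k * int a"
    using eq by (intro exI[of _ j] exI[of _ k]) auto
next
  assume "\<exists>j k. j \<in> {1..a - 1} \<and> k \<ge> 1 \<and> int n = int j * int b - k * int a"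
  then obtain j k where jk: "j \<in> {1..a - 1}" "k \<ge> 1" "int n = int j * int b - k * int a"
    by blast
  show "n \<notin> semigroup_gen2 a b"
  proof
    assume "n \<in> semigroup_gen2 a b"
    then obtain p q where pq: "int n = p * int a + q * int b" "p \<ge> 0" "q \<ge> 0"
      unfolding semigroup_gen2_iff_int by blast
    have eq: "int b * (int j - q) = int a * (p + k)"
      using jk(3) pq(1) by (simp add: algebra_simps)
    have "int a * (p + k) > 0"
      using pq(2) jk(2) assms(1) by simp
    then have pos: "int j - q > 0"
      unfolding eq[symmetric] by (simp add: zero_less_mult_iff)
    have "int a dvd int b * (int j - q)"
      unfolding eq by simp
    then have "int a dvd int j - q"
      using assms(2) by (simp add: coprime_dvd_mult_right_iff)
    then have "int a \<le> int j - q"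
      using pos by (rule zdvd_imp_le)
    then show False
      using jk(1) pq(3) by auto
  qed
qed

text \<open>
  The pairs \<open>(j, k)\<close> parametrize the gaps \<open>x\<close> of the quotient through \<open>d x = j b - k a\<close>. The
  parametrization is injective: if two pairs give the same \<open>x\<close>, then \<open>a\<close> divides \<open>b\<close> times the
  difference of the two values of \<open>j\<close>, which both lie below \<open>a\<close>.
\<close>
lemma genus_quotient_gen2_eq_sum:
  fixes a b d :: nat
  assumes "a > 0" "d > 0" "coprime a b"
  shows "genus (semigroup_quotient (semigroup_gen2 a b) d) =
    (\<Sum>j\<in>{1..a - 1}. card {k::int. 1 \<le> k \<and> k * int a \<le> int j * int b \<and>
        int d dvd int j * int b - k * int a})"
proof -
  define K where "K j = {k::int. 1 \<le> k \<and> k * int a \<le> int j * int b \<and>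
        int d dvd int j * int b - k * int a}" for j :: nat
  define f where "f = (\<lambda>(j::nat, k). nat ((int j * int b - k * int a) div int d))"
  have f: "int d * int (f (j, k)) = int j * int b - k * int a" if "k \<in> K j" for j k
    using that unfolding f_def K_def by (simp add: pos_imp_zdiv_nonneg_iff assms(2))
  have fin: "finite (K j)" for j
  proof (rule finite_subset)
    show "K j \<subseteq> {1..int j * int b}"
    proof
      fix k assume "k \<in> K j"
      then have "1 \<le> k" "k * int a \<le> int j * int b"
        unfolding K_def by auto
      moreover have "k * 1 \<le> k * int a"
        using \<open>1 \<le> k\<close> assms(1) by (intro mult_left_mono) auto
      ultimately have "1 \<le> k" "k \<le> int j * int b"
        by linarith+
      then show "k \<in> {1..int j * int b}"
        by simp
    qed
  qed simp
  have inj: "inj_on f (Sigma {1..a - 1} K)"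
  proof (rule inj_onI, clarify)
    fix i k j l
    assume *: "i \<in> {1..a - 1}" "k \<in> K i" "j \<in> {1..a - 1}" "l \<in> K j" "f (i, k) = f (j, l)"
    then have eq: "int i * int b - k * int a = int j * int b - l * int a"
      using f by metis
    then have "int b * (int i - int j) = int a * (k - l)"
      by (simp add: algebra_simps)
    then have "i = j"
      using * assms(1) by (intro coprime_mult_dvd_diff_imp_eq[OF assms(3)]) auto
    then show "i = j \<and> k = l"
      using eq assms(1) by simp
  qed
  have "UNIV - semigroup_quotient (semigroup_gen2 a b) d = f ` Sigma {1..a - 1} K"
  proof (intro equalityI subsetI)
    fix x assume "x \<in> UNIV - semigroup_quotient (semigroup_gen2 a b) d"
    then have "d * x \<notin> semigroup_gen2 a b"
      by (simp add: semigroup_quotient_def)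
    then obtain j k where jk: "j \<in> {1..a - 1}" "k \<ge> 1"
      and eq: "int (d * x) = int j * int b - k * int a"
      unfolding gap_gen2_iff[OF assms(1,3)] by blast
    have "int j * int b - k * int a \<ge> 0"
      unfolding eq[symmetric] by simp
    moreover have "int d dvd int j * int b - k * int a"
      unfolding eq[symmetric] by simp
    ultimately have "k \<in> K j"
      using jk unfolding K_def by auto
    moreover have "f (j, k) = x"
    proof -
      have "int d * int (f (j, k)) = int d * int x"
        using f[OF \<open>k \<in> K j\<close>] eq by simp
      then show ?thesis
        using assms(2) by simp
    qed
    ultimately show "x \<in> f ` Sigma {1..a - 1} K"
      using jk by (intro image_eqI[of _ _ "(j, k)"]) auto
  next
    fix x assume "x \<in> f ` Sigma {1..a - 1} K"
    then obtain j k where jk: "j \<in> {1..a - 1}" "k \<in> K j" "x = f (j, k)"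
      by auto
    then have "int (d * x) = int j * int b - k * int a" "k \<ge> 1"
      using f[OF jk(2)] by (auto simp: K_def)
    then have "d * x \<notin> semigroup_gen2 a b"
      unfolding gap_gen2_iff[OF assms(1,3)] using jk by blast
    then show "x \<in> UNIV - semigroup_quotient (semigroup_gen2 a b) d"
      by (simp add: semigroup_quotient_def)
  qed
  then have "genus (semigroup_quotient (semigroup_gen2 a b) d) = card (Sigma {1..a - 1} K)"
    unfolding genus_def using inj by (simp add: card_image)
  also have "\<dots> = (\<Sum>j\<in>{1..a - 1}. card (K j))"
    using fin by simp
  finally show ?thesis
    unfolding K_def .
qed

section \<open>Sums of integer quotients\<close>

lemma le_int_div_iff:
  fixes d n t :: int
  assumes "d > 0"
  shows "t \<le> n div d \<longleftrightarrow> t * d \<le> n"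
proof
  assume "t \<le> n div d"
  then have "t * d \<le> n div d * d"
    using assms by simp
  also have "\<dots> \<le> n"
    using assms by (simp add: minus_mod_eq_div_mult[symmetric])
  finally show "t * d \<le> n" .
next
  assume "t * d \<le> n"
  then have "t * d div d \<le> n div d"
    using assms by (rule zdiv_mono1)
  then show "t \<le> n div d"
    using assms by simp
qed

text \<open>
  The members of the class of \<open>c\<close> are \<open>c + d t\<close>, and \<open>1 \<le> c + d t \<le> N\<close> says that \<open>t\<close> lies in the
  half-open interval between the two quotients.
\<close>
lemma card_residue_class_atLeastAtMost:
  fixes c d N :: int
  assumes "d > 0" "N \<ge> 0"
  shows "int (card {k. 1 \<le> k \<and> k \<le> N \<and> d dvd k - c}) = (N - c) div d - (- c) div d"
proof -
  have lower: "1 \<le> c + d * t \<longleftrightarrow> (- c) div d < t" for t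
    using le_int_div_iff[OF assms(1), of t "- c"] by (auto simp: algebra_simps)
  have upper: "c + d * t \<le> N \<longleftrightarrow> t \<le> (N - c) div d" for t
    using le_int_div_iff[OF assms(1), of t "N - c"] by (auto simp: algebra_simps)
  have "{k. 1 \<le> k \<and> k \<le> N \<and> d dvd k - c} = (\<lambda>t. c + d * t) ` {(- c) div d <.. (N - c) div d}"
  proof (intro equalityI subsetI)
    fix k assume k: "k \<in> {k. 1 \<le> k \<and> k \<le> N \<and> d dvd k - c}"
    then obtain t where "k - c = d * t"
      by auto
    then have "k = c + d * t"
      by simp
    then show "k \<in> (\<lambda>t. c + d * t) ` {(- c) div d <.. (N - c) div d}"
      using k lower upper by auto
  next
    fix k assume "k \<in> (\<lambda>t. c + d * t) ` {(- c) div d <.. (N - c) div d}"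
    then show "k \<in> {k. 1 \<le> k \<and> k \<le> N \<and> d dvd k - c}"
      using lower upper by auto
  qed
  moreover have "inj_on (\<lambda>t. c + d * t) A" for A
    using assms(1) by (simp add: inj_on_def)
  ultimately have "card {k. 1 \<le> k \<and> k \<le> N \<and> d dvd k - c} = nat ((N - c) div d - (- c) div d)"
    by (simp add: card_image)
  moreover have "(- c) div d \<le> (N - c) div d"
    using assms by (intro zdiv_mono1) auto
  ultimately show ?thesis
    by simp
qed

lemma neg_div_eq:
  fixes c d :: int
  assumes "d > 0"
  shows "(- c) div d = - (c div d) - (if d dvd c then 0 else 1)"
  using assms by (simp add: zdiv_zminus1_eq_if dvd_eq_mod_eq_0)

text \<open>
  Reflecting \<open>j\<close> to \<open>a - j\<close> pairs the quotients of \<open>- j q\<close> and \<open>j q - a q\<close>. As \<open>a\<close> does not divide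
  \<open>j q\<close>, each pair has the constant sum \<open>- q - 1\<close>.
\<close>
lemma sum_neg_mult_div_coprime:
  fixes a :: nat and q :: int
  assumes "a > 0" "coprime (int a) q"
  shows "2 * (\<Sum>j\<in>{1..a - 1}. (- (int j * q)) div int a) = - ((int a - 1) * (q + 1))"
proof -
  define F where "F j = (- (int j * q)) div int a" for j
  have pair: "F j + F (a - j) = - q - 1" if "j \<in> {1..a - 1}" for j
  proof -
    have "\<not> int a dvd int j"
      using that by (auto dest: dvd_imp_le)
    then have "\<not> int a dvd int j * q"
      using assms(2) by (simp add: coprime_dvd_mult_left_iff)
    then have "F j = - ((int j * q) div int a) - 1"
      unfolding F_def using assms(1) by (simp add: neg_div_eq)
    moreover have "F (a - j) = (int j * q) div int a - q"
    proof -
      have "int (a - j) = int a - int j"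
        using that by auto
      then have "- (int (a - j) * q) = int j * q + (- q) * int a"
        by (simp add: algebra_simps)
      then show ?thesis
        unfolding F_def using assms(1) by (simp only: div_mult_self1)
    qed
    ultimately show ?thesis
      by simp
  qed
  have "(\<Sum>j\<in>{1..a - 1}. F j) = (\<Sum>j\<in>{1..a - 1}. F (a - j))"
    by (rule sum.reindex_bij_witness[of _ "\<lambda>j. a - j" "\<lambda>j. a - j"]) auto
  then have "2 * (\<Sum>j\<in>{1..a - 1}. F j) = (\<Sum>j\<in>{1..a - 1}. F j + F (a - j))"
    by (simp add: sum.distrib)
  also have "\<dots> = (\<Sum>j\<in>{1..a - 1}. - q - 1)"
    using pair by (intro sum.cong) auto
  also have "\<dots> = - ((int a - 1) * (q + 1))"
    using assms(1) by (simp add: of_nat_diff algebra_simps)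
  finally show ?thesis
    unfolding F_def .
qed

lemma multiples_atLeastAtMost_eq_image:
  fixes d n :: nat
  assumes "d > 0"
  shows "{j\<in>{1..n}. d dvd j} = (\<lambda>i. d * i) ` {1..n div d}"
proof (intro equalityI subsetI)
  fix j assume "j \<in> {j\<in>{1..n}. d dvd j}"
  then obtain i where i: "j = d * i" "1 \<le> d * i" "d * i \<le> n"
    by auto
  then have "i \<le> n div d"
    using assms by (simp add: less_eq_div_iff_mult_less_eq mult.commute)
  then show "j \<in> (\<lambda>i. d * i) ` {1..n div d}"
    using i(1,2) by (intro image_eqI[of _ _ i]) (auto simp: Suc_le_eq)
next
  fix j assume "j \<in> (\<lambda>i. d * i) ` {1..n div d}"
  then show "j \<in> {j\<in>{1..n}. d dvd j}"
    using assms by (auto simp: less_eq_div_iff_mult_less_eq mult.commute)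
qed

text \<open>
  The summand is \<open>- \<lceil>e j / d\<rceil>\<close>. The multiples \<open>j = d i\<close> give the exact values \<open>- e i\<close>, an
  arithmetic progression; at the other \<open>j\<close>, the ceiling exceeds the floor by one.
\<close>
lemma sum_neg_mult_div_split:
  fixes d n :: nat and e :: int
  assumes "d > 0" "coprime (int d) e"
  shows "2 * (\<Sum>j\<in>{1..n}. (- (e * int j)) div int d) =
    - (e * int (n div d) * (int (n div d) + 1)) - 2 * (int n - int (n div d))
    - 2 * (\<Sum>j | 1 \<le> j \<and> j \<le> n \<and> \<not> d dvd j. (e * int j) div int d)"
proof -
  define M where "M = {j\<in>{1..n}. d dvd j}"
  define R where "R = {j. 1 \<le> j \<and> j \<le> n \<and> \<not> d dvd j}"
  have split: "{1..n} = M \<union> R" "M \<inter> R = {}" "finite M"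
    unfolding M_def R_def by auto
  have "finite R"
    unfolding R_def by (rule finite_subset[of _ "{1..n}"]) auto
  have inj: "inj_on (\<lambda>i. d * i) A" for A
    using assms(1) by (simp add: inj_on_def)
  have M_eq: "M = (\<lambda>i. d * i) ` {1..n div d}"
    unfolding M_def using assms(1) by (rule multiples_atLeastAtMost_eq_image)
  have "card M = n div d"
    unfolding M_eq by (simp add: card_image inj)
  moreover have "card M + card R = n"
    using card_Un_disjoint[OF split(3) \<open>finite R\<close> split(2)] by (simp flip: split(1))
  ultimately have card_R: "int (card R) = int n - int (n div d)"
    by linarith
  have "(\<Sum>j\<in>M. (- (e * int j)) div int d) = (\<Sum>i\<in>{1..n div d}. - (e * int i))"
    unfolding M_eq sum.reindex[OF inj] o_def
  proof (rule sum.cong)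
    fix i
    have "- (e * int (d * i)) = - (e * int i) * int d"
      by simp
    also have "\<dots> div int d = - (e * int i)"
      using assms(1) by (subst nonzero_mult_div_cancel_right) simp_all
    finally show "- (e * int (d * i)) div int d = - (e * int i)" .
  qed simp
  also have "\<dots> = - (e * (\<Sum>i\<in>{1..n div d}. int i))"
    by (simp add: sum_negf sum_distrib_left)
  finally have "2 * (\<Sum>j\<in>M. (- (e * int j)) div int d) =
      - (e * (2 * (\<Sum>i\<in>{1..n div d}. int i)))"
    by simp
  also have "\<dots> = - (e * int (n div d) * (int (n div d) + 1))"
    using double_gauss_sum_from_Suc_0[of "n div d", where 'a = int] by (simp add: mult.assoc)
  finally have sum_M: "2 * (\<Sum>j\<in>M. (- (e * int j)) div int d) =
      - (e * int (n div d) * (int (n div d) + 1))" .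
  have "(\<Sum>j\<in>R. (- (e * int j)) div int d) = (\<Sum>j\<in>R. - ((e * int j) div int d) - 1)"
  proof (rule sum.cong)
    fix j assume "j \<in> R"
    then have "\<not> int d dvd e * int j"
      using assms(2) by (simp add: R_def coprime_dvd_mult_right_iff)
    then show "(- (e * int j)) div int d = - ((e * int j) div int d) - 1"
      using assms(1) by (simp add: neg_div_eq)
  qed simp
  also have "\<dots> = - (\<Sum>j\<in>R. (e * int j) div int d) - (int n - int (n div d))"
    by (simp add: sum_subtractf sum_negf card_R)
  finally have sum_R: "(\<Sum>j\<in>R. (- (e * int j)) div int d) =
      - (\<Sum>j\<in>R. (e * int j) div int d) - (int n - int (n div d))" .
  have "(\<Sum>j\<in>{1..n}. (- (e * int j)) div int d) =
      (\<Sum>j\<in>M. (- (e * int j)) div int d) + (\<Sum>j\<in>R. (- (e * int j)) div int d)"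
    unfolding split(1) by (rule sum.union_disjoint[OF split(3) \<open>finite R\<close> split(2)])
  then show ?thesis
    unfolding R_def[symmetric] by (simp add: distrib_left sum_M sum_R right_diff_distrib)
qed

section \<open>The genus of the quotient\<close>

text \<open>
  As \<open>s\<close> inverts \<open>a\<close> modulo \<open>d\<close>, the admissible \<open>k\<close> form the residue class of \<open>c = s b j\<close>. The
  upper quotient in the count, \<open>(j b div a - c) div d = (j b (1 - a s)) div (a d)\<close>, loses its
  factor \<open>d\<close> because \<open>1 - a s = - d m\<close>.
\<close>
lemma card_divisible_gaps_eq:
  fixes a b d j :: nat and s m :: int
  assumes "a > 0" "d > 0" "coprime a d" "int a * s = 1 + int d * m"
  shows "int (card {k::int. 1 \<le> k \<and> k * int a \<le> int j * int b \<and>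
      int d dvd int j * int b - k * int a}) =
    (- (int j * (int b * m))) div int a - (- (s * int b * int j)) div int d"
proof -
  define N where "N = (int j * int b) div int a"
  define c where "c = s * int b * int j"
  have "k * int a \<le> int j * int b \<longleftrightarrow> k \<le> N" for k
    unfolding N_def using le_int_div_iff[of "int a" k "int j * int b"] assms(1) by simp
  moreover have "int d dvd int j * int b - k * int a \<longleftrightarrow> int d dvd k - c" for k
  proof -
    have "int a * (k - c) = int j * int b * (1 - int a * s) - (int j * int b - k * int a)"
      unfolding c_def by (simp add: algebra_simps)
    also have "\<dots> = int d * (- int j * int b * m) - (int j * int b - k * int a)"
      unfolding assms(4) by (simp add: algebra_simps)
    finally have "int a * (k - c) = int d * (- int j * int b * m) - (int j * int b - k * int a)" .
    then have "int d dvd int a * (k - c) \<longleftrightarrow> int d dvd int j * int b - k * int a"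
      by (simp add: dvd_diff_right_iff)
    moreover have "int d dvd int a * (k - c) \<longleftrightarrow> int d dvd k - c"
      using assms(3) by (simp add: coprime_dvd_mult_right_iff coprime_commute)
    ultimately show ?thesis
      by simp
  qed
  ultimately have "int (card {k::int. 1 \<le> k \<and> k * int a \<le> int j * int b \<and>
      int d dvd int j * int b - k * int a}) = int (card {k. 1 \<le> k \<and> k \<le> N \<and> int d dvd k - c})"
    by simp
  also have "\<dots> = (N - c) div int d - (- c) div int d"
    using assms(1,2) by (intro card_residue_class_atLeastAtMost)
      (auto simp: N_def pos_imp_zdiv_nonneg_iff)
  also have "(N - c) div int d = (- (int j * (int b * m))) div int a"
  proof -
    have "N - c = (int j * int b + (- c) * int a) div int a"
      unfolding N_def using assms(1) by (simp only: div_mult_self1)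
    also have "int j * int b + (- c) * int a = int j * int b * (1 - int a * s)"
      unfolding c_def by (simp add: algebra_simps)
    also have "\<dots> = (- (int j * (int b * m))) * int d"
      unfolding assms(4) by (simp add: algebra_simps)
    finally have "(N - c) div int d = ((- (int j * (int b * m))) * int d) div (int a * int d)"
      by (simp add: zdiv_zmult2_eq)
    also have "\<dots> = (- (int j * (int b * m))) div int a"
      using assms(2) by (intro div_mult_mult2) simp
    finally show ?thesis .
  qed
  finally show ?thesis
    unfolding c_def .
qed

theorem corollary2p1:
  fixes a b d :: nat and astar :: int
  assumes "a > 0" and "b > 0" and "d \<ge> 2"
    and "coprime a b" and "coprime a d" and "coprime b d"
    and "[int a * astar = 1] (mod int d)" and "1 \<le> astar" and "astar \<le> int d - 1"
  shows "real (genus (semigroup_quotient (semigroup_gen2 a b) d)) =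
      (real a - 1) * (real b + real d - real_of_int astar * real a * real b) / (2 * real d)
    + 1 / 2 * real_of_int \<lfloor>(real a - 1) / real d\<rfloor>
        * (real_of_int astar * real b * real_of_int \<lfloor>(real a - 1) / real d\<rfloor>
           + real_of_int astar * real b - 2)
    + (\<Sum>j\<in>{j::nat. 1 \<le> j \<and> j \<le> a - 1 \<and> \<not> d dvd j}.
         real_of_int \<lfloor>real_of_int astar * real b * real j / real d\<rfloor>)"
proof -
  define g where "g = genus (semigroup_quotient (semigroup_gen2 a b) d)"
  define Q where "Q = (a - 1) div d"
  define T where "T = (\<Sum>j | 1 \<le> j \<and> j \<le> a - 1 \<and> \<not> d dvd j.
    (astar * int b * int j) div int d)"
  have d: "d > 0"
    using assms(3) by simp
  have "int d dvd int a * astar - 1"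
    using assms(7) by (simp add: cong_iff_dvd_diff)
  then obtain m where "int a * astar - 1 = int d * m" ..
  then have m: "int a * astar = 1 + int d * m"
    by simp
  have "coprime (int a) m"
  proof (rule coprimeI)
    fix c assume "c dvd int a" "c dvd m"
    then have "c dvd int a * astar - int d * m"
      by simp
    then show "is_unit c"
      unfolding m by simp
  qed
  then have cop_a: "coprime (int a) (int b * m)"
    using assms(4) by simp
  have "coprime (int d) astar"
  proof (rule coprimeI)
    fix c assume "c dvd int d" "c dvd astar"
    then have "c dvd int a * astar - int d * m"
      by simp
    then show "is_unit c"
      unfolding m by simp
  qed
  then have cop_d: "coprime (int d) (astar * int b)"
    using assms(6) by (simp add: coprime_commute)

  have "int g = (\<Sum>j\<in>{1..a - 1}. (- (int j * (int b * m))) div int a) -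
      (\<Sum>j\<in>{1..a - 1}. (- (astar * int b * int j)) div int d)"
    unfolding g_def genus_quotient_gen2_eq_sum[OF assms(1) d assms(4)] of_nat_sum
      card_divisible_gaps_eq[OF assms(1) d assms(5) m] by (rule sum_subtractf)
  then have "2 * int g = - ((int a - 1) * (int b * m + 1)) +
      astar * int b * int Q * (int Q + 1) + 2 * (int a - 1 - int Q) + 2 * T"
    using sum_neg_mult_div_coprime[OF assms(1) cop_a]
      sum_neg_mult_div_split[OF d cop_d, of "a - 1"] assms(1)
    unfolding Q_def T_def by (simp add: of_nat_diff)
  then have "real_of_int (2 * int g) = real_of_int (- ((int a - 1) * (int b * m + 1)) +
      astar * int b * int Q * (int Q + 1) + 2 * (int a - 1 - int Q) + 2 * T)"
    by (rule arg_cong)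
  then have g: "real g = (real a - 1) * (1 - real b * of_int m) / 2 +
      1 / 2 * real Q * (of_int astar * real b * real Q + of_int astar * real b - 2) + of_int T"
    by (simp add: field_simps)

  have "real a * of_int astar = 1 + real d * of_int m"
    using arg_cong[OF m, of real_of_int] by simp
  then have "real b + real d - of_int astar * real a * real b =
      real d * (1 - real b * of_int m)"
    by algebra
  then have main: "(real a - 1) * (real b + real d - of_int astar * real a * real b) / (2 * real d) =
      (real a - 1) * (1 - real b * of_int m) / 2"
    using d by simp
  have "(real a - 1) / real d = real (a - 1) / real d"
    using assms(1) by (simp add: of_nat_diff)
  then have "\<lfloor>(real a - 1) / real d\<rfloor> = int Q"
    unfolding Q_def by (simp only: floor_divide_of_nat_eq)
  then have floor_Q: "real_of_int \<lfloor>(real a - 1) / real d\<rfloor> = real Q"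
    by simp
  have "\<lfloor>real_of_int astar * real b * real j / real d\<rfloor> = (astar * int b * int j) div int d" for j
    using floor_divide_of_int_eq[of "astar * int b * int j" "int d", where 'a = real] by simp
  then have "(\<Sum>j\<in>{j::nat. 1 \<le> j \<and> j \<le> a - 1 \<and> \<not> d dvd j}.
      real_of_int \<lfloor>real_of_int astar * real b * real j / real d\<rfloor>) = of_int T"
    unfolding T_def by simp
  then show ?thesis
    unfolding g_def[symmetric] main floor_Q using g by simp
qed

end
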